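(* Let $n,m,l\in\mathbb{N}$ with $1\le m\le n-1$ and $m+1\le l\le n-1$, and let $(M_{m,n-l}(t),N_{m,l-m}(t))$ be a Luchko pair of kernels from the subset $T_{n,m,l}\subset L_n$. Then, for the general fractional derivative $D_{(N)}$ of Riemann-Liouville type and the general fractional integral $I_{(M)}$ associated with this pair, the equality $$D_{(N)} I_{(M)} X(t) = X(t)$$ holds (for $t>0$) for every $X(t)\in C_{-1}(0,\infty)$.
   Context: $C_{-1}(0,\infty)$ is the space of functions $f$ on $(0,\infty)$ that can be represented as $f(t)=t^p g(t)$ for $t>0$ with some $p>-1$ and $g\in C[0,\infty)$. $C_{-1,0}(0,\infty)$ is the space of functions $f$ on $(0,\infty)$ that can be represented as $f(t)=t^p g(t)$ for $t>0$ with some $-1<p<0$ and $g\in C[0,\infty)$. The symbol $*$ denotes the Laplace convolution $(f*g)(t)=\int_0^t f(t-\tau)g(\tau)\,d\tau$, $t>0$. $\{1\}$ is the function identically equal to $1$, and for $n\in\mathbb{N}$, $\{1\}^n$ is its $n$-fold convolution power, $\{1\}^n=h_n(t)=\frac{t^{n-1}}{(n-1)!}$. For $n\in\mathbb{N}$, the Luchko set $L_n$ is the set of pairs $(M(t),N(t))$ (Luchko pairs) with $M,N\in C_{-1}(0,\infty)$ such that $(M*N)(t)=\{1\}^n$ for all $t\in(0,\infty)$. A Sonine pair is a pair $(\mu(t),\nu(t))$ with $\mu,\nu\in C_{-1,0}(0,\infty)$ and $(\mu*\nu)(t)=\{1\}$ for all $t\in(0,\infty)$; Sonine pairs belong to $L_1$.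 $T_m$ is the subset of $L_m$ consisting of the pairs in $L_m$ of the form $(\mu_1*\ldots*\mu_m,\ \nu_1*\ldots*\nu_m)$, where $(\mu_k,\nu_k)$ are Sonine pairs from $L_1$ for all $k=1,\dots,m$. $T_{n,m,l}$ is the subset of $L_n$ consisting of the pairs in $L_n$ of the form $$M_{m,n-l}(t)=(\{1\}^{n-l}*M_m)(t),\quad N_{m,l-m}(t)=(\{1\}^{l-m}*N_m)(t)$$ with $(M_m(t),N_m(t))\in T_m$. For $(M_{m,n-l},N_{m,l-m})\in T_{n,m,l}$: the general fractional integral is $I_{(M)}X(t)=(M_{m,n-l}*X)(t)=\int_0^t M_{m,n-l}(t-\tau)X(\tau)\,d\tau$ for $X\in C_{-1}(0,\infty)$; the general fractional derivative of Riemann-Liouville type is $D_{(N)}X(t)=\frac{d^n}{dt^n}(N_{m,l-m}*X)(t)=\frac{d^n}{dt^n}\int_0^t N_{m,l-m}(t-\tau)X(\tau)\,d\tau$ for $X\in C_{-1}(0,\infty)$. *)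

theory Defs
  imports "HOL-Analysis.Analysis"
begin

text \<open>A function on \<open>(0,\<infinity>)\<close> is represented by a total function \<^typ>\<open>real \<Rightarrow> real\<close> whose values
  outside \<open>(0,\<infinity>)\<close> are irrelevant; accordingly, functions are only ever compared at \<open>t > 0\<close>.\<close>

definition C_m1 :: "(real \<Rightarrow> real) set" where
  "C_m1 = {f. \<exists>p g. -1 < p \<and> continuous_on {0..} g \<and> (\<forall>t>0. f t = t powr p * g t)}"

definition C_m1_0 :: "(real \<Rightarrow> real) set" where
  "C_m1_0 = {f. \<exists>p g. -1 < p \<and> p < 0 \<and> continuous_on {0..} g \<and> (\<forall>t>0. f t = t powr p * g t)}"

text \<open>The open interval of integration ensures that only values on \<open>(0,\<infinity>)\<close> enter.\<close>

definition laplace_conv :: "(real \<Rightarrow> real) \<Rightarrow> (real \<Rightarrow> real) \<Rightarrow> real \<Rightarrow> real" where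
  "laplace_conv f g t = (LBINT \<tau>:{0<..<t}. f (t - \<tau>) * g \<tau>)"

text \<open>\<open>conv_prod f m\<close> is \<open>f\<^sub>1 * \<dots> * f\<^sub>m\<close>, bracketed to the left. There is no convolution unit among
  the functions, so the empty product is a dummy value, relevant only outside the range \<open>m \<ge> 1\<close>.\<close>

fun conv_prod :: "(nat \<Rightarrow> real \<Rightarrow> real) \<Rightarrow> nat \<Rightarrow> real \<Rightarrow> real" where
  "conv_prod f 0 = (\<lambda>_. 0)"
| "conv_prod f (Suc 0) = f 1"
| "conv_prod f (Suc (Suc k)) = laplace_conv (conv_prod f (Suc k)) (f (Suc (Suc k)))"

definition one_pow :: "nat \<Rightarrow> real \<Rightarrow> real" where
  "one_pow n = conv_prod (\<lambda>_ _. 1) n"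

lemma one_pow_eq:
  assumes "n \<ge> 1" "t > 0"
  shows "one_pow n t = t ^ (n - 1) / fact (n - 1)"
proof -
  have "one_pow (Suc k) t = t ^ k / fact k" if "t > 0" for k t
    using that
  proof (induction k arbitrary: t)
    case 0
    then show ?case by (simp add: one_pow_def)
  next
    case (Suc k)
    have "one_pow (Suc (Suc k)) t = (LBINT \<tau>:{0<..<t}. one_pow (Suc k) (t - \<tau>))"
      by (simp add: one_pow_def laplace_conv_def)
    also have "\<dots> = (LBINT \<tau>:{0<..<t}. (t - \<tau>) ^ k / fact k)"
      by (intro set_lebesgue_integral_cong) (auto simp: Suc.IH)
    also have "\<dots> = (LBINT \<tau>=ereal 0..ereal t. (t - \<tau>) ^ k / fact k)"
      using Suc.prems by (simp add: interval_lebesgue_integral_le_eq)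
    also have "\<dots> = - ((t - t) ^ Suc k / fact (Suc k)) - - ((t - 0) ^ Suc k / fact (Suc k))"
    proof (rule interval_integral_FTC_finite)
      show "((\<lambda>x. - ((t - x) ^ Suc k / fact (Suc k))) has_vector_derivative (t - x) ^ k / fact k)
              (at x within {min 0 t..max 0 t})" for x
      proof -
        have "((\<lambda>x. - ((t - x) ^ Suc k / fact (Suc k))) has_real_derivative
                (real (Suc k) * (t - x) ^ k) / fact (Suc k)) (at x within {min 0 t..max 0 t})"
          by (rule derivative_eq_intros refl | force)+
        moreover have "(real (Suc k) * (t - x) ^ k) / fact (Suc k) = (t - x) ^ k / fact k"
          unfolding fact_Suc of_nat_mult by (simp del: of_nat_Suc)
        ultimately show ?thesis
          by (simp only: has_real_derivative_iff_has_vector_derivative)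
      qed
    qed (intro continuous_intros, simp)
    finally show ?case by simp
  qed
  from this[of t "n - 1"] assms show ?thesis by simp
qed

definition luchko_set :: "nat \<Rightarrow> ((real \<Rightarrow> real) \<times> (real \<Rightarrow> real)) set" where
  "luchko_set n = {(M, N). M \<in> C_m1 \<and> N \<in> C_m1 \<and> (\<forall>t>0. laplace_conv M N t = one_pow n t)}"

definition sonine_pair :: "(real \<Rightarrow> real) \<Rightarrow> (real \<Rightarrow> real) \<Rightarrow> bool" where
  "sonine_pair \<mu> \<nu> \<longleftrightarrow> \<mu> \<in> C_m1_0 \<and> \<nu> \<in> C_m1_0 \<and> (\<forall>t>0. laplace_conv \<mu> \<nu> t = 1)"

lemma sonine_pair_imp_luchko: "sonine_pair \<mu> \<nu> \<Longrightarrow> (\<mu>, \<nu>) \<in> luchko_set 1"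
  by (auto simp: sonine_pair_def luchko_set_def one_pow_def C_m1_def C_m1_0_def)

definition T_set :: "nat \<Rightarrow> ((real \<Rightarrow> real) \<times> (real \<Rightarrow> real)) set" where
  "T_set m = {(M, N). (M, N) \<in> luchko_set m \<and>
     (\<exists>\<mu> \<nu>. (\<forall>k\<in>{1..m}. sonine_pair (\<mu> k) (\<nu> k)) \<and>
       (\<forall>t>0. M t = conv_prod \<mu> m t \<and> N t = conv_prod \<nu> m t))}"

definition T_set3 :: "nat \<Rightarrow> nat \<Rightarrow> nat \<Rightarrow> ((real \<Rightarrow> real) \<times> (real \<Rightarrow> real)) set" where
  "T_set3 n m l = {(M, N). (M, N) \<in> luchko_set n \<and>
     (\<exists>(M', N') \<in> T_set m.
       \<forall>t>0. M t = laplace_conv (one_pow (n - l)) M' t \<and> N t = laplace_conv (one_pow (l - m)) N' t)}"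

definition gfi :: "(real \<Rightarrow> real) \<Rightarrow> (real \<Rightarrow> real) \<Rightarrow> real \<Rightarrow> real" where
  "gfi M X = laplace_conv M X"

text \<open>Since \<^const>\<open>deriv\<close> is total, \<open>gfd n N X\<close> is meaningful only together with \<open>gfd_exists n N X\<close>.\<close>

definition gfd :: "nat \<Rightarrow> (real \<Rightarrow> real) \<Rightarrow> (real \<Rightarrow> real) \<Rightarrow> real \<Rightarrow> real" where
  "gfd n N X = (deriv ^^ n) (laplace_conv N X)"

definition gfd_exists :: "nat \<Rightarrow> (real \<Rightarrow> real) \<Rightarrow> (real \<Rightarrow> real) \<Rightarrow> bool" where
  "gfd_exists n N X \<longleftrightarrow>
     (\<forall>k<n. \<forall>t>0. (deriv ^^ k) (laplace_conv N X) field_differentiable at t)"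

end

theory Submission imports Defs begin

text \<open>
  Convolution turns the composition \<open>N * (M * X)\<close> into \<open>(M * N) * X = {1}\<^sup>n * X\<close>, because it is
  associative and commutative on \<open>C\<^sub>-\<^sub>1(0,\<infinity>)\<close>. Convolution with \<open>{1}\<close> is integration from \<open>0\<close>, so
  \<open>{1}\<^sup>n * X\<close> is the \<open>n\<close>-fold iterated integral of \<open>X\<close>. Since every function of the space is
  continuous on \<open>(0,\<infinity>)\<close>, each differentiation there undoes one integration, and \<open>n\<close> of them
  return \<open>X\<close>. A pair in \<open>T\<^sub>n\<^sub>,\<^sub>m\<^sub>,\<^sub>l\<close> is a Luchko pair, that is,
  \<open>M * N = {1}\<^sup>n\<close>, so this argument covers it (\<open>gfd_gfi_luchko\<close>).

  The analytic work lies in showing that all these integrals converge. For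
  \<open>f(x) = x\<^sup>p g(x)\<close> and \<open>k(x) = x\<^sup>q h(x)\<close> the substitution \<open>\<tau> = t s\<close> moves the domain of
  integration to the fixed interval \<open>(0,1)\<close> and gives
  \<open>(f * k)(t) = t\<^bsup>p+q+1\<^esup> \<integral>\<^sub>0\<^sup>1 (1-s)\<^sup>p s\<^sup>q g(t(1-s)) h(ts) ds\<close>. As \<open>g\<close> and \<open>h\<close> are bounded on compact
  intervals, the integrand is dominated, locally uniformly in \<open>t\<close>, by a multiple of the integrand of a
  Beta integral.
  Hence the integral exists and is continuous in \<open>t\<close> up to \<open>t = 0\<close>, and the space is closed
  under convolution (\<open>laplace_conv_C_m1\<close>). Applied to the absolute values of the functions, this
  closure also supplies the integrability that Fubini's theorem needs for associativity
  (\<open>laplace_conv_assoc\<close>).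
\<close>

section \<open>Convolution as an integral over the whole line\<close>

text \<open>Extension by zero from \<open>(0,\<infinity>)\<close> absorbs the limits of integration of the convolution into
  the integrand, so affine substitutions and Fubini's theorem apply without tracking domains.\<close>

definition restrict_pos :: "(real \<Rightarrow> real) \<Rightarrow> real \<Rightarrow> real" where
  "restrict_pos f x = (if 0 < x then f x else 0)"

lemma laplace_conv_restrict_pos:
  "laplace_conv f g t = (\<integral>\<tau>. restrict_pos f (t - \<tau>) * restrict_pos g \<tau> \<partial>lborel)"
  unfolding laplace_conv_def set_lebesgue_integral_def restrict_pos_def
  by (rule Bochner_Integration.integral_cong) (auto simp: indicator_def)

lemma laplace_conv_nonpos: "t \<le> 0 \<Longrightarrow> laplace_conv f g t = 0"
  by (simp add: laplace_conv_def set_lebesgue_integral_def)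

lemma laplace_conv_cong:
  assumes "\<And>x. 0 < x \<Longrightarrow> f x = f' x" "\<And>x. 0 < x \<Longrightarrow> g x = g' x"
  shows "laplace_conv f g = laplace_conv f' g'"
proof -
  have "restrict_pos f = restrict_pos f'" "restrict_pos g = restrict_pos g'"
    using assms by (auto simp: restrict_pos_def)
  then show ?thesis by (simp add: laplace_conv_restrict_pos fun_eq_iff)
qed

section \<open>Closure of the function space under convolution\<close>

lemma C_m1_abs:
  assumes "f \<in> C_m1" shows "(\<lambda>x. \<bar>f x\<bar>) \<in> C_m1"
proof -
  obtain p g where "-1 < p" "continuous_on {0..} g" "\<forall>t>0. f t = t powr p * g t"
    using assms by (auto simp: C_m1_def)
  then show ?thesis
    unfolding C_m1_def mem_Collect_eq
    by (intro exI[of _ p] exI[of _ "\<lambda>x. \<bar>g x\<bar>"]) (auto intro!: continuous_intros simp: abs_mult)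
qed

lemma C_m1_continuous_on:
  assumes "f \<in> C_m1" shows "continuous_on {0<..} f"
proof -
  obtain p g where "-1 < p" and g: "continuous_on {0..} g" and f: "\<forall>t>0. f t = t powr p * g t"
    using assms by (auto simp: C_m1_def)
  have "continuous_on {0<..} (\<lambda>t. t powr p * g t)"
    by (intro continuous_intros continuous_on_subset[OF g]) auto
  then show ?thesis
    by (rule continuous_on_eq) (use f in auto)
qed

lemma restrict_pos_measurable:
  assumes "f \<in> C_m1" shows "restrict_pos f \<in> borel_measurable borel"
proof -
  have "(\<lambda>x. indicator {0<..} x *\<^sub>R f x) \<in> borel_measurable borel"
    by (intro borel_measurable_continuous_on_indicator C_m1_continuous_on assms) auto
  also have "(\<lambda>x. indicator {0<..} x *\<^sub>R f x) = restrict_pos f"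
    by (auto simp: restrict_pos_def indicator_def)
  finally show ?thesis .
qed

text \<open>The integrand of \<open>f * k\<close> for \<open>f(x) = x\<^sup>p g(x)\<close> and \<open>k(x) = x\<^sup>q h(x)\<close>, after the substitution
  \<open>\<tau> = t s\<close> and removal of the factor \<open>t\<^bsup>p+q\<^esup>\<close>.\<close>

definition beta_integrand ::
  "real \<Rightarrow> real \<Rightarrow> (real \<Rightarrow> real) \<Rightarrow> (real \<Rightarrow> real) \<Rightarrow> real \<Rightarrow> real \<Rightarrow> real" where
  "beta_integrand p q g h t s =
     indicator {0<..<1} s *\<^sub>R ((1 - s) powr p * s powr q * (g (t * (1 - s)) * h (t * s)))"

lemma beta_integrand_measurable:
  assumes "continuous_on {0..} g" "continuous_on {0..} h" "0 \<le> t"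
  shows "beta_integrand p q g h t \<in> borel_measurable borel"
proof -
  have "continuous_on {0<..<1} (\<lambda>s. (1 - s) powr p * s powr q * (g (t * (1 - s)) * h (t * s)))"
    by (intro continuous_intros continuous_on_compose2[OF assms(1)]
          continuous_on_compose2[OF assms(2)]) (use assms(3) in auto)
  then show ?thesis
    unfolding beta_integrand_def by (intro borel_measurable_continuous_on_indicator) auto
qed

text \<open>For \<open>s\<close> in \<open>(0,1)\<close> and \<open>t \<le> T\<close> both arguments \<open>t(1-s)\<close> and \<open>ts\<close> stay in \<open>[0,T]\<close>, where the
  continuous factors are bounded. What remains is a Beta integrand with parameters \<open>q+1, p+1 > 0\<close>.
  The bound does not depend on \<open>t\<close>, so that it serves both for the existence of the integral and
  for its continuity as a function of \<open>t\<close>.\<close>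

lemma beta_integrand_dominated:
  assumes g: "continuous_on {0..} g" and h: "continuous_on {0..} h" and "-1 < p" "-1 < q"
  obtains w where "integrable lborel w"
    "\<And>t s. 0 \<le> t \<Longrightarrow> t \<le> T \<Longrightarrow> norm (beta_integrand p q g h t s) \<le> w s"
proof -
  have "bounded (g ` {0..T})" "bounded (h ` {0..T})"
    by (intro compact_imp_bounded compact_continuous_image continuous_on_subset[OF g]
          continuous_on_subset[OF h]; force)+
  then obtain A B where A: "\<And>x. 0 \<le> x \<Longrightarrow> x \<le> T \<Longrightarrow> \<bar>g x\<bar> \<le> A"
      and B: "\<And>x. 0 \<le> x \<Longrightarrow> x \<le> T \<Longrightarrow> \<bar>h x\<bar> \<le> B"
    by (fastforce simp: bounded_iff)
  define w where
    "w s = A * B * (indicator {0..1} s *\<^sub>R (s powr ((q + 1) - 1) * (1 - s) powr ((p + 1) - 1)))" for s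
  show ?thesis
  proof
    show "integrable lborel w"
      unfolding w_def using integrable_Beta[of "q + 1" "p + 1"] assms
      by (intro integrable_mult_right) (simp_all add: set_integrable_def)
    show "norm (beta_integrand p q g h t s) \<le> w s" if t: "0 \<le> t" "t \<le> T" for t s
    proof (cases "s \<in> {0<..<1}")
      case True
      have "t * s \<le> t * 1" "t * (1 - s) \<le> t * 1"
        by (intro mult_left_mono; use True t in simp)+
      then have "\<bar>g (t * (1 - s)) * h (t * s)\<bar> \<le> A * B"
        unfolding abs_mult using True t A B
        by (intro mult_mono) (auto intro: order_trans[OF abs_ge_zero])
      then have "((1 - s) powr p * s powr q) * \<bar>g (t * (1 - s)) * h (t * s)\<bar>
          \<le> ((1 - s) powr p * s powr q) * (A * B)"
        by (rule mult_left_mono) auto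
      with True show ?thesis
        by (simp add: beta_integrand_def w_def abs_mult mult_ac)
    next
      case False
      have "0 \<le> A * B"
        using A[of 0] B[of 0] t by (intro mult_nonneg_nonneg) auto
      with False show ?thesis
        by (auto simp: beta_integrand_def w_def indicator_def)
    qed
  qed
qed

lemma beta_integrand_integrable:
  assumes "continuous_on {0..} g" "continuous_on {0..} h" "-1 < p" "-1 < q" "0 \<le> t"
  shows "integrable lborel (beta_integrand p q g h t)"
proof -
  obtain w where w: "integrable lborel w"
    "\<And>u s. 0 \<le> u \<Longrightarrow> u \<le> t \<Longrightarrow> norm (beta_integrand p q g h u s) \<le> w s"
    using beta_integrand_dominated[OF assms(1-4)] by blast
  show ?thesis
  proof (rule Bochner_Integration.integrable_bound[OF w(1)])
    show "beta_integrand p q g h t \<in> borel_measurable lborel"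
      using beta_integrand_measurable[OF assms(1,2,5)] by simp
    have "norm (beta_integrand p q g h t s) \<le> norm (w s)" for s
      using w(2)[OF assms(5) order_refl, of s] by simp
    then show "AE s in lborel. norm (beta_integrand p q g h t s) \<le> norm (w s)"
      by simp
  qed
qed

lemma beta_integral_continuous_on:
  assumes g: "continuous_on {0..} g" and h: "continuous_on {0..} h" and pq: "-1 < p" "-1 < q"
  shows "continuous_on {0..} (\<lambda>t. \<integral>s. beta_integrand p q g h t s \<partial>lborel)"
  unfolding continuous_on_sequentially
proof (intro allI ballI impI, elim conjE)
  fix u :: "nat \<Rightarrow> real" and a :: real
  assume a: "a \<in> {0..}" and u: "\<forall>n. u n \<in> {0..}" and lim: "u \<longlonglongrightarrow> a"
  have "Bseq u"
    using lim by (intro convergent_imp_Bseq convergentI)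
  then obtain T where "\<And>n. norm (u n) \<le> T"
    by (auto simp: Bseq_def)
  then have T: "u n \<le> T" for n
    by (metis abs_le_D1 real_norm_def)
  obtain w where w: "integrable lborel w"
    "\<And>t s. 0 \<le> t \<Longrightarrow> t \<le> T \<Longrightarrow> norm (beta_integrand p q g h t s) \<le> w s"
    using beta_integrand_dominated[OF g h pq] by blast
  have "(\<lambda>n. \<integral>s. beta_integrand p q g h (u n) s \<partial>lborel)
      \<longlonglongrightarrow> (\<integral>s. beta_integrand p q g h a s \<partial>lborel)"
  proof (rule integral_dominated_convergence[OF _ _ w(1)])
    show "beta_integrand p q g h a \<in> borel_measurable lborel"
      using beta_integrand_measurable[OF g h] a by simp
    show "beta_integrand p q g h (u n) \<in> borel_measurable lborel" for n
      using beta_integrand_measurable[OF g h] u by simp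
    show "AE s in lborel. norm (beta_integrand p q g h (u n) s) \<le> w s" for n
      using w(2) u T by auto
    show "AE s in lborel. (\<lambda>n. beta_integrand p q g h (u n) s) \<longlonglongrightarrow> beta_integrand p q g h a s"
    proof (rule AE_I2)
      fix s :: real
      show "(\<lambda>n. beta_integrand p q g h (u n) s) \<longlonglongrightarrow> beta_integrand p q g h a s"
      proof (cases "s \<in> {0<..<1}")
        case True
        have "(\<lambda>n. g (u n * (1 - s))) \<longlonglongrightarrow> g (a * (1 - s))"
          by (rule continuous_on_tendsto_compose[OF g])
             (use True a u lim in \<open>auto intro!: tendsto_intros\<close>)
        moreover have "(\<lambda>n. h (u n * s)) \<longlonglongrightarrow> h (a * s)"
          by (rule continuous_on_tendsto_compose[OF h])
             (use True a u lim in \<open>auto intro!: tendsto_intros\<close>)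
        ultimately show ?thesis
          unfolding beta_integrand_def by (intro tendsto_intros)
      qed (simp add: beta_integrand_def)
    qed
  qed
  then show "((\<lambda>t. \<integral>s. beta_integrand p q g h t s \<partial>lborel) \<circ> u)
      \<longlonglongrightarrow> (\<integral>s. beta_integrand p q g h a s \<partial>lborel)"
    by (simp add: o_def)
qed

lemma conv_integrand_scaled:
  assumes "\<forall>x>0. f x = x powr p * g x" "\<forall>x>0. k x = x powr q * h x" "0 < t"
  shows "restrict_pos f (t - (0 + t * s)) * restrict_pos k (0 + t * s)
    = t powr (p + q) * beta_integrand p q g h t s"
proof (cases "s \<in> {0<..<1}")
  case True
  have *: "t - t * s = t * (1 - s)" by (simp add: algebra_simps)
  have "0 < t * s" "0 < t * (1 - s)" using True assms(3) by auto
  with True assms show ?thesis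
    by (simp add: restrict_pos_def beta_integrand_def * powr_mult powr_add)
next
  case False
  have "0 < t * s \<longleftrightarrow> 0 < s" "0 < t - t * s \<longleftrightarrow> s < 1"
    using assms(3) by (auto simp: zero_less_mult_iff)
  with False show ?thesis
    by (auto simp: restrict_pos_def beta_integrand_def)
qed

lemma laplace_conv_integrable:
  assumes "f \<in> C_m1" "k \<in> C_m1"
  shows "integrable lborel (\<lambda>\<tau>. restrict_pos f (t - \<tau>) * restrict_pos k \<tau>)"
proof (cases "0 < t")
  case True
  obtain p g where f: "-1 < p" "continuous_on {0..} g" "\<forall>t>0. f t = t powr p * g t"
    using assms(1) by (auto simp: C_m1_def)
  obtain q h where k: "-1 < q" "continuous_on {0..} h" "\<forall>t>0. k t = t powr q * h t"
    using assms(2) by (auto simp: C_m1_def)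
  have "integrable lborel (\<lambda>s. restrict_pos f (t - (0 + t * s)) * restrict_pos k (0 + t * s))"
    unfolding conv_integrand_scaled[OF f(3) k(3) True]
    by (intro integrable_mult_right beta_integrand_integrable) (use f k True in auto)
  then show ?thesis
    using True lborel_integrable_real_affine_iff[of t
        "\<lambda>\<tau>. restrict_pos f (t - \<tau>) * restrict_pos k \<tau>" 0] by simp
next
  case False
  then have "(\<lambda>\<tau>. restrict_pos f (t - \<tau>) * restrict_pos k \<tau>) = (\<lambda>_. 0)"
    by (auto simp: restrict_pos_def)
  then show ?thesis by simp
qed

lemma laplace_conv_C_m1:
  assumes "f \<in> C_m1" "k \<in> C_m1"
  shows "laplace_conv f k \<in> C_m1"
proof -
  obtain p g where f: "-1 < p" "continuous_on {0..} g" "\<forall>t>0. f t = t powr p * g t"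
    using assms(1) by (auto simp: C_m1_def)
  obtain q h where k: "-1 < q" "continuous_on {0..} h" "\<forall>t>0. k t = t powr q * h t"
    using assms(2) by (auto simp: C_m1_def)
  have "laplace_conv f k t = t powr (p + q + 1) * (\<integral>s. beta_integrand p q g h t s \<partial>lborel)"
    if "0 < t" for t
  proof -
    have "laplace_conv f k t
        = \<bar>t\<bar> *\<^sub>R (\<integral>s. restrict_pos f (t - (0 + t * s)) * restrict_pos k (0 + t * s) \<partial>lborel)"
      unfolding laplace_conv_restrict_pos using that by (intro lborel_integral_real_affine) auto
    also have "\<dots> = t * (t powr (p + q) * (\<integral>s. beta_integrand p q g h t s \<partial>lborel))"
      unfolding conv_integrand_scaled[OF f(3) k(3) that] using that by simp
    also have "\<dots> = t powr (p + q + 1) * (\<integral>s. beta_integrand p q g h t s \<partial>lborel)"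
      using that by (simp add: powr_add)
    finally show ?thesis .
  qed
  then show ?thesis
    unfolding C_m1_def mem_Collect_eq
    using beta_integral_continuous_on[OF f(2) k(2) f(1) k(1)] f(1) k(1)
    by (intro exI[of _ "p + q + 1"] exI[of _ "\<lambda>t. \<integral>s. beta_integrand p q g h t s \<partial>lborel"]) force
qed

section \<open>Commutativity and associativity of the convolution\<close>

lemma laplace_conv_commute: "laplace_conv f g = laplace_conv g f"
proof
  fix t
  show "laplace_conv f g t = laplace_conv g f t"
    unfolding laplace_conv_restrict_pos
    using lborel_integral_real_affine[of "-1" "\<lambda>\<tau>. restrict_pos f (t - \<tau>) * restrict_pos g \<tau>" t]
    by (simp add: mult.commute)
qed

lemma restrict_pos_laplace_conv: "restrict_pos (laplace_conv f g) = laplace_conv f g"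
  by (auto simp: restrict_pos_def laplace_conv_nonpos)

text \<open>Both sides are iterated integrals of the kernel \<open>?K\<close> in the two possible orders; the
  translation \<open>\<tau> = s + u\<close> identifies the second one. The inner integral of \<open>\<bar>?K\<bar>\<close> is itself a
  convolution of absolute values, which lie in the space again, so closure under
  convolution yields absolute integrability.\<close>

lemma laplace_conv_assoc:
  assumes "f \<in> C_m1" "g \<in> C_m1" "h \<in> C_m1"
  shows "laplace_conv f (laplace_conv g h) = laplace_conv (laplace_conv f g) h"
proof
  fix t
  note [measurable] = assms[THEN restrict_pos_measurable]
  let ?K = "\<lambda>\<tau> s. restrict_pos f (t - \<tau>) * (restrict_pos g (\<tau> - s) * restrict_pos h s)"
  have restrict_abs: "restrict_pos (\<lambda>x. \<bar>a x\<bar>) y = \<bar>restrict_pos a y\<bar>" for a y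
    by (simp add: restrict_pos_def)
  have "integrable (lborel \<Otimes>\<^sub>M lborel) (case_prod ?K)"
  proof (rule lborel_pair.Fubini_integrable)
    show "case_prod ?K \<in> borel_measurable (lborel \<Otimes>\<^sub>M lborel)" by measurable
    have "(\<integral>s. norm (case (\<tau>, s) of (\<tau>, s) \<Rightarrow> ?K \<tau> s) \<partial>lborel) =
        restrict_pos (\<lambda>x. \<bar>f x\<bar>) (t - \<tau>) * restrict_pos (laplace_conv (\<lambda>x. \<bar>g x\<bar>) (\<lambda>x. \<bar>h x\<bar>)) \<tau>" for \<tau>
      unfolding restrict_pos_laplace_conv laplace_conv_restrict_pos restrict_abs by (simp add: abs_mult)
    then show "integrable lborel (\<lambda>\<tau>. \<integral>s. norm (case (\<tau>, s) of (\<tau>, s) \<Rightarrow> ?K \<tau> s) \<partial>lborel)"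
      using laplace_conv_integrable[OF C_m1_abs laplace_conv_C_m1[OF C_m1_abs C_m1_abs],
          OF assms] by simp
    show "AE \<tau> in lborel. integrable lborel (\<lambda>s. case (\<tau>, s) of (\<tau>, s) \<Rightarrow> ?K \<tau> s)"
      using laplace_conv_integrable[OF assms(2,3)] by simp
  qed
  from lborel_pair.Fubini_integral[OF this]
  have swap: "(\<integral>\<tau>. (\<integral>s. ?K \<tau> s \<partial>lborel) \<partial>lborel) = (\<integral>s. (\<integral>\<tau>. ?K \<tau> s \<partial>lborel) \<partial>lborel)"
    by simp
  have inner_s: "(\<integral>s. ?K \<tau> s \<partial>lborel) = restrict_pos f (t - \<tau>) * restrict_pos (laplace_conv g h) \<tau>"
    for \<tau>
    unfolding restrict_pos_laplace_conv laplace_conv_restrict_pos by simp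
  have inner_tau: "(\<integral>\<tau>. ?K \<tau> s \<partial>lborel) = restrict_pos (laplace_conv f g) (t - s) * restrict_pos h s"
    for s
  proof -
    have "(\<integral>\<tau>. ?K \<tau> s \<partial>lborel)
        = (\<integral>u. restrict_pos f (t - s - u) * restrict_pos g u * restrict_pos h s \<partial>lborel)"
      using lborel_integral_real_affine[of 1 "\<lambda>\<tau>. ?K \<tau> s" s] by (simp add: algebra_simps)
    then show ?thesis
      unfolding restrict_pos_laplace_conv laplace_conv_restrict_pos by simp
  qed
  show "laplace_conv f (laplace_conv g h) t = laplace_conv (laplace_conv f g) h t"
    using swap unfolding inner_s inner_tau
    by (simp only: laplace_conv_restrict_pos[of f "laplace_conv g h"]
        laplace_conv_restrict_pos[of "laplace_conv f g" h])
qed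

section \<open>Convolution with the constant one is inverse to differentiation\<close>

lemma one_C_m1: "(\<lambda>_. 1) \<in> C_m1"
  unfolding C_m1_def mem_Collect_eq by (intro exI[of _ 0] exI[of _ "\<lambda>_. 1"]) auto

lemma laplace_conv_one_has_derivative:
  assumes "f \<in> C_m1" "0 < t"
  shows "(laplace_conv (\<lambda>_. 1) f has_field_derivative f t) (at t)"
proof -
  \<comment> \<open>\<open>f\<close> may be singular at \<open>0\<close>, so the fundamental theorem is applied only on an interval
    around \<open>t\<close> that stays away from \<open>0\<close>; the integral up to \<open>a\<close> is a constant.\<close>
  define a b where "a = t / 2" and "b = t + 1"
  have ab: "0 < a" "a < t" "t < b" using assms(2) by (auto simp: a_def b_def)
  have split: "laplace_conv (\<lambda>_. 1) f u = (LBINT \<tau>:{0<..<a}. f \<tau>) + integral {a..u} f"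
    if u: "u \<in> {a<..<b}" for u
  proof -
    have "integrable lborel (\<lambda>\<tau>. restrict_pos (\<lambda>_. 1) (u - \<tau>) * restrict_pos f \<tau>)"
      by (intro laplace_conv_integrable one_C_m1 assms)
    also have "(\<lambda>\<tau>. restrict_pos (\<lambda>_. 1) (u - \<tau>) * restrict_pos f \<tau>)
        = (\<lambda>\<tau>. indicator {0<..<u} \<tau> *\<^sub>R f \<tau>)"
      by (auto simp: restrict_pos_def indicator_def)
    finally have int: "set_integrable lborel {0<..<u} f"
      by (simp add: set_integrable_def)
    have "laplace_conv (\<lambda>_. 1) f u = (LBINT \<tau>:{0<..<u}. f \<tau>)"
      by (simp add: laplace_conv_def)
    also have "{0<..<u} = {0<..<a} \<union> {a..<u}" using u ab by auto
    also have "(LBINT \<tau>:{0<..<a} \<union> {a..<u}. f \<tau>) = (LBINT \<tau>:{0<..<a}. f \<tau>) + (LBINT \<tau>:{a..<u}. f \<tau>)"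
      by (intro set_integral_Un set_integrable_subset[OF int]) (use u ab in auto)
    also have "(LBINT \<tau>:{a..<u}. f \<tau>) = integral {a..<u} f"
      by (intro set_borel_integral_eq_integral set_integrable_subset[OF int]) (use u ab in auto)
    also have "integral {a..<u} f = integral {a..u} f"
      by (rule integral_subset_negligible) (auto intro: negligible_subset[of "{u}"])
    finally show ?thesis .
  qed
  have "((\<lambda>u. integral {a..u} f) has_field_derivative f t) (at t within {a..b})"
    by (intro integral_has_real_derivative continuous_on_subset[OF C_m1_continuous_on[OF assms(1)]])
       (use ab in auto)
  then have "((\<lambda>u. (LBINT \<tau>:{0<..<a}. f \<tau>) + integral {a..u} f) has_field_derivative f t) (at t)"
    using ab by (auto intro!: derivative_eq_intros simp: at_within_Icc_at)
  then show ?thesis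
    by (rule has_field_derivative_transform_within_open[of _ _ _ "{a<..<b}"])
       (use ab split in auto)
qed

lemma one_pow_C_m1: "one_pow (Suc k) \<in> C_m1"
  by (induction k) (auto simp: one_pow_def intro: one_C_m1 laplace_conv_C_m1)

lemma funpow_one_C_m1: "f \<in> C_m1 \<Longrightarrow> (laplace_conv (\<lambda>_. 1) ^^ k) f \<in> C_m1"
  by (induction k) (auto intro: one_C_m1 laplace_conv_C_m1)

text \<open>The power \<open>{1}\<^sup>k\<^sup>+\<^sup>1\<close> is built by appending a factor on the right; associativity moves that
  factor onto \<open>f\<close>, which is why the induction runs over all \<open>f\<close>.\<close>

lemma laplace_conv_one_pow:
  assumes "f \<in> C_m1"
  shows "laplace_conv (one_pow (Suc k)) f = (laplace_conv (\<lambda>_. 1) ^^ Suc k) f"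
  using assms
proof (induction k arbitrary: f)
  case 0
  then show ?case by (simp add: one_pow_def)
next
  case (Suc k)
  have "laplace_conv (one_pow (Suc (Suc k))) f
      = laplace_conv (laplace_conv (one_pow (Suc k)) (\<lambda>_. 1)) f"
    by (simp add: one_pow_def)
  also have "\<dots> = laplace_conv (one_pow (Suc k)) (laplace_conv (\<lambda>_. 1) f)"
    by (simp add: laplace_conv_assoc one_pow_C_m1 one_C_m1 Suc.prems)
  also have "\<dots> = (laplace_conv (\<lambda>_. 1) ^^ Suc k) (laplace_conv (\<lambda>_. 1) f)"
    by (intro Suc.IH laplace_conv_C_m1 one_C_m1 Suc.prems)
  finally show ?case by (simp add: funpow_swap1)
qed

text \<open>The identity holds only at positive points, but \<open>(0,\<infinity>)\<close> is open, so this already determines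
  the next derivative.\<close>

lemma deriv_funpow_laplace_conv_one:
  assumes "f \<in> C_m1" "k \<le> n" "0 < t"
  shows "(deriv ^^ k) ((laplace_conv (\<lambda>_. 1) ^^ n) f) t = (laplace_conv (\<lambda>_. 1) ^^ (n - k)) f t"
  using assms(2,3)
proof (induction k arbitrary: t)
  case (Suc k)
  let ?J = "laplace_conv (\<lambda>_. 1)"
  have n: "n - k = Suc (n - Suc k)" using Suc.prems by simp
  have "(deriv ^^ Suc k) ((?J ^^ n) f) t = deriv ((?J ^^ (n - k)) f) t"
    unfolding funpow.simps o_apply
    by (rule deriv_cong_ev)
       (use Suc in \<open>auto intro!: eventually_mono[OF eventually_nhds_in_open[of "{0<..}"]]\<close>)
  also have "\<dots> = (?J ^^ (n - Suc k)) f t"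
    unfolding n funpow.simps o_apply
    by (intro DERIV_imp_deriv laplace_conv_one_has_derivative funpow_one_C_m1 assms Suc.prems)
  finally show ?case .
qed simp

lemma deriv_funpow_laplace_conv_one_differentiable:
  assumes "f \<in> C_m1" "k < n" "0 < t"
  shows "(deriv ^^ k) ((laplace_conv (\<lambda>_. 1) ^^ n) f) field_differentiable at t"
proof -
  let ?J = "laplace_conv (\<lambda>_. 1)"
  have n: "n - k = Suc (n - Suc k)" using assms by simp
  have "(?J ((?J ^^ (n - Suc k)) f) has_field_derivative (?J ^^ (n - Suc k)) f t) (at t)"
    by (intro laplace_conv_one_has_derivative funpow_one_C_m1 assms)
  then have "((?J ^^ (n - k)) f has_field_derivative (?J ^^ (n - Suc k)) f t) (at t)"
    unfolding n by simp
  then have "((deriv ^^ k) ((?J ^^ n) f) has_field_derivative (?J ^^ (n - Suc k)) f t) (at t)"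
    by (rule has_field_derivative_transform_within_open[of _ _ _ "{0<..}"])
       (use assms in \<open>auto simp: deriv_funpow_laplace_conv_one\<close>)
  then show ?thesis
    by (auto simp: field_differentiable_def)
qed

section \<open>The fundamental theorem for Luchko pairs\<close>

lemma gfd_gfi_luchko:
  assumes "0 < n" "(M, N) \<in> luchko_set n" "X \<in> C_m1"
  shows "gfi M X \<in> C_m1 \<and> gfd_exists n N (gfi M X) \<and> (\<forall>t>0. gfd n N (gfi M X) t = X t)"
proof -
  have M: "M \<in> C_m1" and N: "N \<in> C_m1" and MN: "\<And>t. 0 < t \<Longrightarrow> laplace_conv M N t = one_pow n t"
    using assms(2) by (auto simp: luchko_set_def)
  have "laplace_conv N (gfi M X) = laplace_conv (laplace_conv M N) X"
    by (simp add: gfi_def laplace_conv_assoc M N assms(3) laplace_conv_commute[of N M])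
  also have "\<dots> = laplace_conv (one_pow n) X"
    by (intro laplace_conv_cong MN) simp_all
  also have "\<dots> = (laplace_conv (\<lambda>_. 1) ^^ n) X"
    using laplace_conv_one_pow[OF assms(3), of "n - 1"] assms(1) by simp
  finally have eq: "laplace_conv N (gfi M X) = (laplace_conv (\<lambda>_. 1) ^^ n) X" .
  show ?thesis
    unfolding gfd_exists_def gfd_def eq
    using assms(3) laplace_conv_C_m1[OF M assms(3)]
    by (simp add: gfi_def deriv_funpow_laplace_conv_one deriv_funpow_laplace_conv_one_differentiable)
qed

theorem theorem8:
  fixes n m l :: nat and M N X :: "real \<Rightarrow> real"
  assumes "1 \<le> m" and "m \<le> n - 1"
    and "m + 1 \<le> l" and "l \<le> n - 1"
    and "(M, N) \<in> T_set3 n m l"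
    and "X \<in> C_m1"
  shows "gfi M X \<in> C_m1 \<and> gfd_exists n N (gfi M X) \<and> (\<forall>t>0. gfd n N (gfi M X) t = X t)"
proof (rule gfd_gfi_luchko)
  show "0 < n" using assms(3,4) by linarith
  show "(M, N) \<in> luchko_set n" using assms(5) by (simp add: T_set3_def)
qed (rule assms(6))

end
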